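(* Let $K\subset\mathbb{R}$ be Borel-measurable. Then $$\mu^{\mathrm{H}}(K)=(\mathrm{H})\int_{\mathbb{R}}\chi_K=(\mathrm{H})\int_K 1 .$$
   Context: $\chi_K:\mathbb{R}\to\mathbb{R}$ is the characteristic function of $K$. $\dim_{\mathrm{H}}$ denotes Hausdorff dimension and $\mu^d$ the $d$-dimensional Hausdorff measure on $\mathbb{R}$ (normalized so that $\mu^0$ is the counting measure and $\mu^1$ is the Lebesgue measure), with $\dim_{\mathrm{H}}\emptyset=0$. For $K\subset\mathbb{R}$ set $\mu^{\mathrm{H}}(K)=(d,m)$, where $d=\dim_{\mathrm{H}}K$ and $m=\mu^d(K)$. Hausdorff-integral: for $L\subset\mathbb{R}$ Borel-measurable and $f:L\to\mathbb{R}$ Borel-measurable, let $D_f=\{x\in L: f(x)\neq 0\}$ and set $(\mathrm{H})\int_L f=(d,m)\in[0,1]\times[-\infty,+\infty]$, where $d=\dim_{\mathrm{H}}D_f$ and $m=\int_{D_f}f\,d\mu^d$, with the convention $\int_\emptyset f\,d\mu^d=0$. *)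

theory Defs
  imports "HOL-Analysis.Analysis"
begin

text \<open>The \<open>d\<close>-th power of the diameter, with the conventions that the empty set costs nothing
  and that every nonempty set (also a singleton) costs \<open>1\<close> for \<open>d = 0\<close>. The latter has to be
  spelled out because \<open>0 powr 0 = 0\<close> in HOL; it makes the 0-dimensional measure the counting
  measure. On the real line this choice makes the 1-dimensional measure the Lebesgue measure.\<close>

definition diam_pow :: "real \<Rightarrow> real set \<Rightarrow> ennreal" where
  "diam_pow d U =
     (if U = {} then 0 else if d = 0 then 1 else ennreal (diameter U powr d))"

text \<open>Boundedness is required explicitly because \<^const>\<open>diameter\<close> is an unspecified real number
  on unbounded sets. Finite covers are included, as the \<open>U i\<close> may be empty.\<close>

definition delta_covers :: "real \<Rightarrow> real set \<Rightarrow> (nat \<Rightarrow> real set) set" where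
  "delta_covers \<delta> A =
     {U. A \<subseteq> (\<Union>i. U i) \<and> (\<forall>i. bounded (U i) \<and> diameter (U i) \<le> \<delta>)}"

definition hausdorff_outer :: "real \<Rightarrow> real set \<Rightarrow> ennreal" where
  "hausdorff_outer d A =
     (SUP \<delta>\<in>{0<..}. INF U\<in>delta_covers \<delta> A. (\<Sum>i. diam_pow d (U i)))"

text \<open>The restriction of the outer measure to the Borel sets, as an object one can integrate
  against.\<close>

definition hausdorff_measure :: "real \<Rightarrow> real measure" where
  "hausdorff_measure d = measure_of UNIV (sets borel) (hausdorff_outer d)"

text \<open>The infimum is over a nonempty set, since every \<open>d > 1\<close> belongs to it; it is \<open>0\<close> for
  the empty set.\<close>

definition hausdorff_dim :: "real set \<Rightarrow> real" where
  "hausdorff_dim A = Inf {d. 0 \<le> d \<and> hausdorff_outer d A = 0}"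

text \<open>The pair \<open>\<mu>\<^sup>H(K)\<close>, defined for arbitrary \<open>K\<close> via the outer measure. The second
  component is embedded in the extended reals so that it can be compared with integrals.\<close>

definition hausdorff_size :: "real set \<Rightarrow> real \<times> ereal" where
  "hausdorff_size K =
     (let d = hausdorff_dim K in (d, enn2ereal (hausdorff_outer d K)))"

text \<open>The integral over \<open>D\<close> with values in the extended reals, as the difference of the integrals
  of the positive and the negative part (\<^const>\<open>ennreal\<close> maps negative reals to \<open>0\<close>). The Bochner
  integral is not used, as it is \<open>0\<close> for non-integrable functions. If both parts are infinite, the
  integral does not exist mathematically and the value below is meaningless.\<close>

definition ereal_set_integral :: "real measure \<Rightarrow> real set \<Rightarrow> (real \<Rightarrow> real) \<Rightarrow> ereal" where
  "ereal_set_integral M D f =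
     enn2ereal (\<integral>\<^sup>+x\<in>D. ennreal (f x) \<partial>M) - enn2ereal (\<integral>\<^sup>+x\<in>D. ennreal (- f x) \<partial>M)"

text \<open>The Hausdorff-integral over \<open>L\<close>; only the values of \<open>f\<close> on \<open>L\<close> matter. It is meant for Borel
  sets \<open>L\<close> and functions \<open>f\<close> that are Borel measurable on \<open>L\<close>.\<close>

definition hausdorff_integral :: "real set \<Rightarrow> (real \<Rightarrow> real) \<Rightarrow> real \<times> ereal" where
  "hausdorff_integral L f =
     (let D = {x \<in> L. f x \<noteq> 0}; d = hausdorff_dim D
      in (d, ereal_set_integral (hausdorff_measure d) D f))"

end

theory Submission
  imports Defs
begin

text \<open>Both integrands are nonzero exactly on \<open>K\<close>, so all three pairs have the same first
  component \<open>d\<close>, and both integrals are the integral of \<open>1\<close> over \<open>K\<close>, which is the measure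
  of \<open>K\<close>. What needs proof is that this measure is the outer measure \<open>\<mu>\<^sup>d(K)\<close>:
  by convention \<^const>\<open>measure_of\<close> yields the zero measure unless the given set function is
  countably additive on the \<open>\<sigma>\<close>-algebra, so one has to know that Hausdorff outer measure is
  countably additive on the Borel sets.

  This is the classical criterion of Caratheodory. An outer measure on a metric space that is
  additive on pairs of sets at positive distance splits every test set along every closed set
  (\<open>closed_in_lambda_system\<close>); as the sets with this splitting property form a \<open>\<sigma>\<close>-algebra on
  which the outer measure is countably additive, it is a measure on the Borel sets. Hausdorff
  outer measure is additive on separated sets because no covering set of diameter less than
  the distance of two sets meets both of them (\<open>hausdorff_outer_separated\<close>). Of the cost of
  a covering set these arguments use only that the empty set costs nothing, so they treat all
  exponents \<open>d\<close> alike.\<close>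

section \<open>Metric outer measures\<close>

definition separated :: "'a::metric_space set \<Rightarrow> 'a set \<Rightarrow> bool" where
  "separated A B \<longleftrightarrow> (\<exists>e>0. \<forall>x\<in>A. \<forall>y\<in>B. e \<le> dist x y)"

lemma separated_infdist:
  assumes "a < b" "\<And>x. x \<in> A \<Longrightarrow> b \<le> infdist x F" "\<And>y. y \<in> B \<Longrightarrow> infdist y F \<le> a"
  shows "separated A B"
  unfolding separated_def
proof (intro exI[of _ "b - a"] conjI ballI)
  fix x y assume "x \<in> A" "y \<in> B"
  then show "b - a \<le> dist x y"
    using assms(2,3) infdist_triangle[of x F y] by fastforce
qed (use assms(1) in auto)

text \<open>Only one inequality is stated for separated sets; the other one is subadditivity.\<close>

definition metric_outer_measure :: "('a::metric_space set \<Rightarrow> ennreal) \<Rightarrow> bool" where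
  "metric_outer_measure m \<longleftrightarrow> outer_measure_space (Pow UNIV) m \<and>
     (\<forall>A B. separated A B \<longrightarrow> m A + m B \<le> m (A \<union> B))"

context
  fixes m :: "'a::metric_space set \<Rightarrow> ennreal"
  assumes metric: "metric_outer_measure m"
begin

lemma outer_empty: "m {} = 0"
  and outer_mono: "A \<subseteq> B \<Longrightarrow> m A \<le> m B"
  and outer_separated: "separated A B \<Longrightarrow> m A + m B \<le> m (A \<union> B)"
  using metric
  by (auto simp: metric_outer_measure_def outer_measure_space_def positive_def increasing_def)

lemma outer_UN: "m (\<Union>i. S i) \<le> (\<Sum>i. m (S i))"
proof -
  have "m (\<Union>i. disjointed S i) \<le> (\<Sum>i. m (disjointed S i))"
    using metric disjoint_family_disjointed[of S]
    unfolding metric_outer_measure_def outer_measure_space_def countably_subadditive_def by blast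
  also have "\<dots> \<le> (\<Sum>i. m (S i))"
    by (intro suminf_le outer_mono disjointed_subset) auto
  finally show ?thesis by (simp add: UN_disjointed_eq)
qed

lemma outer_Un: "m (A \<union> B) \<le> m A + m B"
proof -
  have "subadditive (Pow UNIV) m"
    using metric
    by (intro ring_of_sets.countably_subadditive_subadditive[OF ring_of_sets_Pow])
      (auto simp: metric_outer_measure_def outer_measure_space_def)
  then have "m (A \<union> (B - A)) \<le> m A + m (B - A)"
    by (intro subadditiveD) auto
  also have "\<dots> \<le> m A + m B"
    by (intro add_left_mono outer_mono) auto
  finally show ?thesis by simp
qed

lemma sum_le_outer_UN:
  fixes S :: "nat \<Rightarrow> 'a set"
  assumes "\<And>n. separated (\<Union>k<n. S k) (S n)"
  shows "(\<Sum>k<n. m (S k)) \<le> m (\<Union>k<n. S k)"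
proof (induction n)
  case (Suc n)
  have "(\<Sum>k<Suc n. m (S k)) \<le> m (\<Union>k<n. S k) + m (S n)"
    using Suc by (simp add: add_right_mono)
  also have "\<dots> \<le> m ((\<Union>k<n. S k) \<union> S n)"
    by (intro outer_separated assms)
  finally show ?case by (simp add: lessThan_Suc Un_commute)
qed simp

text \<open>Cut \<open>T - F\<close> into shells according to the distance from \<open>F\<close>. Neighbouring shells may
  touch, but every other shell is separated from its predecessors. So the shells with even index
  have total measure at most that of \<open>T\<close>, likewise those with odd index, and the sum over all
  shells converges. Its tail bounds what is lost when \<open>T - F\<close> is replaced by its part outside
  a neighbourhood of \<open>F\<close>, and that part is separated from \<open>F\<close>.\<close>

lemma outer_split_closed:
  assumes F: "closed F"
  shows "m (T \<inter> F) + m (T - F) \<le> m T"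
  \<comment> \<open>The distance from the empty set is \<open>0\<close> by convention, which would spoil the shells.\<close>
proof (cases "F = {} \<or> m T = \<infinity>")
  case True
  then show ?thesis by (auto simp: outer_empty)
next
  case False
  then have ne: "F \<noteq> {}" and fin: "m T < \<infinity>" by (auto simp: less_top)
  define A where "A n = {x \<in> T. 1 / real (Suc n) \<le> infdist x F}" for n
  define R where "R n = A (Suc n) - A n" for n
  have A_mono: "A i \<subseteq> A j" if "i \<le> j" for i j
  proof -
    have "1 / real (Suc j) \<le> 1 / real (Suc i)"
      using that by (simp add: frac_le)
    then show ?thesis unfolding A_def by auto
  qed
  have A_sub: "A n \<subseteq> T - F" for n
    by (auto simp: A_def)
  have A_reaches: "\<exists>n. x \<in> A n" if "x \<in> T - F" for x
  proof -
    have "0 < infdist x F"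
      using infdist_pos_not_in_closed[OF F ne] that by auto
    then obtain n where "1 / real (Suc n) < infdist x F"
      using nat_approx_posE by metis
    then show ?thesis using that by (auto simp: A_def intro!: exI[of _ n])
  qed
  have decomp: "T - F \<subseteq> A n \<union> (\<Union>k. R (k + n))" for n
  proof
    fix x assume "x \<in> T - F"
    then obtain i where i: "x \<in> A (i + n)"
      using A_reaches A_mono[of _ "_ + n"] by (meson le_add1 subsetD)
    then show "x \<in> A n \<union> (\<Union>k. R (k + n))"
      by (induction i) (auto simp: R_def)
  qed
  have every_other: "(\<Sum>k<n. m (R (2 * k + j))) \<le> m T" for n j
  proof -
    have "separated (\<Union>k<n. R (2 * k + j)) (R (2 * n + j))" for n
    proof (cases n)
      case 0
      then show ?thesis by (auto simp: separated_def intro: exI[of _ 1])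
    next
      case (Suc i)
      \<comment> \<open>The earlier shells lie in \<open>A (2 * i + j + 1)\<close>, the next one outside \<open>A (2 * i + j + 2)\<close>.\<close>
      show ?thesis
      proof (rule separated_infdist[where F = F])
        show "1 / real (2 * i + j + 3) < 1 / real (2 * i + j + 2)"
          by (simp add: frac_less2)
      next
        fix x assume "x \<in> (\<Union>k<n. R (2 * k + j))"
        then obtain k where "k \<le> i" "x \<in> A (Suc (2 * k + j))"
          by (auto simp: R_def Suc less_Suc_eq_le)
        then have "x \<in> A (2 * i + j + 1)"
          using A_mono[of "Suc (2 * k + j)" "2 * i + j + 1"] by auto
        then show "1 / real (2 * i + j + 2) \<le> infdist x F"
          by (simp add: A_def add.commute)
      next
        fix y assume "y \<in> R (2 * n + j)"
        then have "y \<in> T" "y \<notin> A (2 * i + j + 2)"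
          using A_sub by (auto simp: R_def Suc)
        then show "infdist y F \<le> 1 / real (2 * i + j + 3)"
          by (simp add: A_def add.commute)
      qed
    qed
    then have "(\<Sum>k<n. m (R (2 * k + j))) \<le> m (\<Union>k<n. R (2 * k + j))"
      by (rule sum_le_outer_UN)
    also have "\<dots> \<le> m T"
      using A_sub by (intro outer_mono) (auto simp: R_def)
    finally show ?thesis .
  qed
  have sums: "(\<Sum>k<2 * n. m (R k)) = (\<Sum>k<n. m (R (2 * k + 0))) + (\<Sum>k<n. m (R (2 * k + 1)))" for n
    by (induction n) (auto simp: algebra_simps)
  have bounded: "(\<Sum>k<n. m (R k)) \<le> m T + m T" for n
  proof -
    have "(\<Sum>k<n. m (R k)) \<le> (\<Sum>k<2 * n. m (R k))"
      by (intro sum_mono2) auto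
    also have "\<dots> \<le> m T + m T"
      unfolding sums by (intro add_mono every_other)
    finally show ?thesis .
  qed
  have "(\<Sum>k. m (R k)) \<le> m T + m T"
    using ennreal_suminf_bound_add[where y = 0] bounded by simp
  then have total: "(\<Sum>k. m (R k)) \<noteq> \<infinity>"
    using fin by (auto simp: top_unique)
  have tail: "(\<lambda>n. \<Sum>k. m (R (k + n))) \<longlonglongrightarrow> 0"
  proof -
    have "m (R k) \<noteq> \<infinity>" for k
      using ennreal_suminf_lessD[of "\<lambda>k. m (R k)" \<infinity> k] total by (auto simp: less_top)
    define r where "r k = enn2real (m (R k))" for k
    have r: "0 \<le> r k" "m (R k) = ennreal (r k)" for k
      using \<open>m (R k) \<noteq> \<infinity>\<close> by (simp_all add: r_def less_top)
    have "summable r"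
      using total r by (intro summable_suminf_not_top) auto
    then have "(\<lambda>n. ennreal (\<Sum>k. r (k + n))) \<longlonglongrightarrow> ennreal 0"
      by (intro tendsto_ennrealI suminf_exist_split2)
    then show ?thesis
      using \<open>summable r\<close> r by (simp add: suminf_ennreal2 summable_ignore_initial_segment)
  qed
  have "m (T \<inter> F) + m (T - F) \<le> m T + (\<Sum>k. m (R (k + n)))" for n
  proof -
    have "separated (A n) (T \<inter> F)"
      by (rule separated_infdist[of 0 "1 / real (Suc n)" _ F]) (auto simp: A_def)
    then have "m (A n) + m (T \<inter> F) \<le> m (A n \<union> T \<inter> F)"
      by (rule outer_separated)
    also have "\<dots> \<le> m T"
      using A_sub by (intro outer_mono) auto
    finally have "m (A n) + m (T \<inter> F) \<le> m T" .
    moreover have "m (T - F) \<le> m (A n) + (\<Sum>k. m (R (k + n)))"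
      using outer_mono[OF decomp[of n]] outer_Un[of "A n" "\<Union>k. R (k + n)"]
        outer_UN[of "\<lambda>k. R (k + n)"] by (meson add_left_mono order_trans)
    ultimately have "m (T \<inter> F) + m (T - F) \<le> (m (A n) + m (T \<inter> F)) + (\<Sum>k. m (R (k + n)))"
      by (metis add.assoc add.commute add_left_mono)
    with \<open>m (A n) + m (T \<inter> F) \<le> m T\<close> show ?thesis
      by (meson add_right_mono order_trans)
  qed
  then have "m (T \<inter> F) + m (T - F) \<le> m T + 0"
    by (intro LIMSEQ_le_const[OF tendsto_add[OF tendsto_const tail]]) auto
  then show ?thesis by simp
qed

lemma closed_in_lambda_system:
  assumes "closed F"
  shows "F \<in> lambda_system UNIV (Pow UNIV) m"
proof -
  have "m (T \<inter> F) + m (T - F) = m T" for T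
    using outer_split_closed[OF assms, of T] outer_Un[of "T \<inter> F" "T - F"]
    by (simp add: Int_Diff_Un order.antisym)
  then show ?thesis
    unfolding algebra.lambda_system_eq[OF algebra_Pow] by simp
qed

lemma measure_space_borel: "measure_space UNIV (sets borel) m"
proof -
  let ?L = "lambda_system UNIV (Pow UNIV) m"
  interpret Pow: sigma_algebra UNIV "Pow UNIV :: 'a set set"
    by (rule sigma_algebra_Pow)
  have ms: "measure_space UNIV ?L m"
    using metric by (intro Pow.caratheodory_lemma) (simp add: metric_outer_measure_def)
  then interpret L: sigma_algebra UNIV ?L
    by (simp add: measure_space_def)
  have "sigma_sets UNIV (Collect closed) \<subseteq> ?L"
    by (intro L.sigma_sets_subset subsetI closed_in_lambda_system) simp
  then have "sets borel \<subseteq> ?L"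
    by (simp add: borel_eq_closed)
  then show ?thesis
    using measure_down[OF ms] sets.sigma_algebra_axioms[of borel] by simp
qed

end

section \<open>Hausdorff outer measure is a metric outer measure\<close>

definition delta_content :: "real \<Rightarrow> real \<Rightarrow> real set \<Rightarrow> ennreal" where
  "delta_content d \<delta> A = (INF U\<in>delta_covers \<delta> A. (\<Sum>i. diam_pow d (U i)))"

lemma hausdorff_outer_eq_SUP: "hausdorff_outer d A = (SUP \<delta>\<in>{0<..}. delta_content d \<delta> A)"
  by (simp add: hausdorff_outer_def delta_content_def)

lemma diam_pow_empty [simp]: "diam_pow d {} = 0"
  by (simp add: diam_pow_def)

lemma delta_content_le: "U \<in> delta_covers \<delta> A \<Longrightarrow> delta_content d \<delta> A \<le> (\<Sum>i. diam_pow d (U i))"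
  unfolding delta_content_def by (rule INF_lower)

lemma delta_content_empty: "0 < \<delta> \<Longrightarrow> delta_content d \<delta> {} = 0"
  using delta_content_le[of "\<lambda>_. {}" \<delta> "{}" d] by (simp add: delta_covers_def)

lemma delta_content_mono: "A \<subseteq> B \<Longrightarrow> delta_content d \<delta> A \<le> delta_content d \<delta> B"
  unfolding delta_content_def by (rule INF_superset_mono) (auto simp: delta_covers_def)

lemma delta_content_antimono: "\<delta> \<le> \<epsilon> \<Longrightarrow> delta_content d \<epsilon> A \<le> delta_content d \<delta> A"
  unfolding delta_content_def
  by (rule INF_superset_mono) (auto simp: delta_covers_def intro: order_trans)

text \<open>Choose for the \<open>n\<close>-th set a cover that is optimal up to \<open>e/2\<^sup>n\<^sup>+\<^sup>1\<close>; all these covers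
  together form a cover of the union.\<close>

lemma delta_content_UN: "delta_content d \<delta> (\<Union>n. A n) \<le> (\<Sum>n. delta_content d \<delta> (A n))"
proof (rule ennreal_le_epsilon)
  fix e :: real
  assume e: "0 < e" and fin: "(\<Sum>n. delta_content d \<delta> (A n)) < top"
  have "\<exists>U\<in>delta_covers \<delta> (A n).
      (\<Sum>i. diam_pow d (U i)) < delta_content d \<delta> (A n) + ennreal (e * (1/2) ^ Suc n)" for n
  proof -
    have "delta_content d \<delta> (A n) < delta_content d \<delta> (A n) + ennreal (e * (1/2) ^ Suc n)"
      using e ennreal_suminf_lessD[OF fin, of n] by (auto simp: less_top)
    then show ?thesis by (subst (asm) delta_content_def) (simp add: INF_less_iff)
  qed
  then obtain U where U: "\<And>n. U n \<in> delta_covers \<delta> (A n)"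
    and cost: "\<And>n. (\<Sum>i. diam_pow d (U n i)) < delta_content d \<delta> (A n) + ennreal (e * (1/2) ^ Suc n)"
    by metis
  define C where "C k = case_prod U (prod_decode k)" for k
  have "C \<in> delta_covers \<delta> (\<Union>n. A n)"
  proof -
    have "(\<Union>n. A n) \<subseteq> (\<Union>k. C k)"
    proof
      fix x assume "x \<in> (\<Union>n. A n)"
      then obtain n i where "x \<in> U n i"
        using U by (fastforce simp: delta_covers_def)
      then have "x \<in> C (prod_encode (n, i))"
        by (simp add: C_def)
      then show "x \<in> (\<Union>k. C k)" by blast
    qed
    then show ?thesis
      using U by (auto simp: delta_covers_def C_def split: prod.split)
  qed
  then have "delta_content d \<delta> (\<Union>n. A n) \<le> (\<Sum>k. diam_pow d (C k))"
    by (rule delta_content_le)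
  also have "\<dots> = (\<Sum>n. \<Sum>i. diam_pow d (U n i))"
    using suminf_ennreal_2dimen[of "\<lambda>n. \<Sum>i. diam_pow d (U n i)" "\<lambda>p. diam_pow d (case_prod U p)"]
    by (simp add: C_def)
  also have "\<dots> \<le> (\<Sum>n. delta_content d \<delta> (A n) + ennreal (e * (1/2) ^ Suc n))"
    using cost by (intro suminf_le) (auto intro: less_imp_le)
  also have "\<dots> = (\<Sum>n. delta_content d \<delta> (A n)) + (\<Sum>n. ennreal (e * (1/2) ^ Suc n))"
    by (intro suminf_add[symmetric]) auto
  also have "(\<Sum>n. ennreal (e * (1/2) ^ Suc n)) = ennreal e"
    using e sums_mult[OF power_half_series, of e] by (intro suminf_ennreal_eq) auto
  finally show "delta_content d \<delta> (\<Union>n. A n) \<le> (\<Sum>n. delta_content d \<delta> (A n)) + ennreal e" .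
qed

text \<open>A set of diameter less than \<open>e\<close> cannot meet two sets at distance at least \<open>e\<close>. Hence a
  cover of their union contains a cover of each of them such that no nonempty covering set is
  used for both.\<close>

lemma delta_content_separated:
  assumes "0 < \<delta>" "\<delta> < e" and far: "\<And>x y. x \<in> A \<Longrightarrow> y \<in> B \<Longrightarrow> e \<le> dist x y"
  shows "delta_content d \<delta> A + delta_content d \<delta> B \<le> delta_content d \<delta> (A \<union> B)"
  unfolding delta_content_def[of d \<delta> "A \<union> B"]
proof (rule INF_greatest)
  fix U assume U: "U \<in> delta_covers \<delta> (A \<union> B)"
  define meeting where "meeting S i = (if U i \<inter> S = {} then {} else U i)" for S i
  have cover: "meeting S \<in> delta_covers \<delta> S" if "S \<subseteq> A \<union> B" for S
    using U that assms(1) by (fastforce simp: delta_covers_def meeting_def)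
  have disjoint_cost: "diam_pow d (meeting A i) + diam_pow d (meeting B i) \<le> diam_pow d (U i)" for i
  proof -
    have "U i \<inter> A = {} \<or> U i \<inter> B = {}"
    proof (rule ccontr)
      assume "\<not> (U i \<inter> A = {} \<or> U i \<inter> B = {})"
      then obtain x y where "x \<in> U i" "x \<in> A" "y \<in> U i" "y \<in> B" by blast
      moreover from U have "bounded (U i)" "diameter (U i) \<le> \<delta>"
        by (auto simp: delta_covers_def)
      ultimately show False
        using far[of x y] diameter_bounded_bound[of "U i" x y] \<open>\<delta> < e\<close> by simp
    qed
    then show ?thesis by (auto simp: meeting_def)
  qed
  have "delta_content d \<delta> A + delta_content d \<delta> B
      \<le> (\<Sum>i. diam_pow d (meeting A i)) + (\<Sum>i. diam_pow d (meeting B i))"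
    by (intro add_mono delta_content_le cover) auto
  also have "\<dots> = (\<Sum>i. diam_pow d (meeting A i) + diam_pow d (meeting B i))"
    by (intro suminf_add) auto
  also have "\<dots> \<le> (\<Sum>i. diam_pow d (U i))"
    by (intro suminf_le disjoint_cost) auto
  finally show "delta_content d \<delta> A + delta_content d \<delta> B \<le> (\<Sum>i. diam_pow d (U i))" .
qed

lemma delta_content_le_hausdorff_outer: "0 < \<delta> \<Longrightarrow> delta_content d \<delta> A \<le> hausdorff_outer d A"
  unfolding hausdorff_outer_eq_SUP by (rule SUP_upper) simp

lemma hausdorff_outer_separated:
  assumes "separated A B"
  shows "hausdorff_outer d A + hausdorff_outer d B \<le> hausdorff_outer d (A \<union> B)"
proof -
  obtain e where e: "0 < e" and far: "\<And>x y. x \<in> A \<Longrightarrow> y \<in> B \<Longrightarrow> e \<le> dist x y"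
    using assms by (auto simp: separated_def)
  have approx: "delta_content d \<delta> A + delta_content d \<epsilon> B \<le> hausdorff_outer d (A \<union> B)"
    if "0 < \<delta>" "0 < \<epsilon>" for \<delta> \<epsilon>
  proof -
    \<comment> \<open>The content grows as the mesh shrinks, so both scales may be refined to one below \<open>e\<close>.\<close>
    define \<eta> where "\<eta> = min (min \<delta> \<epsilon>) (e / 2)"
    have \<eta>: "0 < \<eta>" "\<eta> \<le> \<delta>" "\<eta> \<le> \<epsilon>" "\<eta> < e"
      using that e by (auto simp: \<eta>_def)
    have "delta_content d \<delta> A + delta_content d \<epsilon> B \<le> delta_content d \<eta> A + delta_content d \<eta> B"
      by (intro add_mono delta_content_antimono \<eta>)
    also have "\<dots> \<le> delta_content d \<eta> (A \<union> B)"
      by (rule delta_content_separated[OF \<eta>(1,4) far])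
    also have "\<dots> \<le> hausdorff_outer d (A \<union> B)"
      by (rule delta_content_le_hausdorff_outer[OF \<eta>(1)])
    finally show ?thesis .
  qed
  have nonempty: "{0::real<..} \<noteq> {}" by auto
  have "delta_content d \<delta> A + hausdorff_outer d B \<le> hausdorff_outer d (A \<union> B)" if "0 < \<delta>" for \<delta>
    unfolding hausdorff_outer_eq_SUP[of d B] ennreal_SUP_add_right[OF nonempty]
    using approx[OF that] by (intro SUP_least) auto
  then show ?thesis
    unfolding hausdorff_outer_eq_SUP[of d A] ennreal_SUP_add_left[OF nonempty, symmetric]
    by (intro SUP_least) auto
qed

lemma metric_outer_measure_hausdorff_outer: "metric_outer_measure (hausdorff_outer d)"
  unfolding metric_outer_measure_def outer_measure_space_def
proof (intro conjI allI impI)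
  show "positive (Pow UNIV) (hausdorff_outer d)"
    by (simp add: positive_def hausdorff_outer_eq_SUP delta_content_empty)
  show "increasing (Pow UNIV) (hausdorff_outer d)"
    by (auto simp: increasing_def hausdorff_outer_eq_SUP intro!: SUP_mono delta_content_mono)
  show "countably_subadditive (Pow UNIV) (hausdorff_outer d)"
    unfolding countably_subadditive_def
  proof (intro allI impI)
    fix A :: "nat \<Rightarrow> real set"
    have "delta_content d \<delta> (\<Union>n. A n) \<le> (\<Sum>n. hausdorff_outer d (A n))" if "0 < \<delta>" for \<delta>
      using delta_content_UN[of d \<delta> A] suminf_le[OF delta_content_le_hausdorff_outer[OF that]]
      by (meson order_trans summableI)
    then show "hausdorff_outer d (\<Union>n. A n) \<le> (\<Sum>n. hausdorff_outer d (A n))"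
      unfolding hausdorff_outer_eq_SUP[of d "\<Union>n. A n"] by (intro SUP_least) auto
  qed
qed (rule hausdorff_outer_separated)

section \<open>Hausdorff size as a Hausdorff integral\<close>

lemma sets_hausdorff_measure [simp]: "sets (hausdorff_measure d) = sets borel"
  unfolding hausdorff_measure_def
  using sets.sigma_algebra_axioms[of "borel :: real measure"]
  by (intro sigma_algebra.sets_measure_of_eq) simp

lemma emeasure_hausdorff_measure:
  assumes "K \<in> sets borel"
  shows "emeasure (hausdorff_measure d) K = hausdorff_outer d K"
proof -
  have "measure_space UNIV (sets borel) (hausdorff_outer d)"
    by (rule measure_space_borel[OF metric_outer_measure_hausdorff_outer])
  then show ?thesis
    using assms unfolding hausdorff_measure_def measure_space_def
    by (intro emeasure_measure_of_sigma) auto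
qed

lemma hausdorff_integral_eq_size:
  assumes K: "K \<in> sets borel"
    and support: "{x \<in> L. f x \<noteq> 0} = K" and one: "\<And>x. x \<in> K \<Longrightarrow> f x = 1"
  shows "hausdorff_integral L f = hausdorff_size K"
proof -
  define M where "M = hausdorff_measure (hausdorff_dim K)"
  have "(\<integral>\<^sup>+x\<in>K. ennreal (f x) \<partial>M) = (\<integral>\<^sup>+x. indicator K x \<partial>M)"
    by (intro nn_integral_cong) (auto simp: one indicator_def)
  also have "\<dots> = hausdorff_outer (hausdorff_dim K) K"
    using K by (simp add: M_def emeasure_hausdorff_measure)
  finally have pos: "(\<integral>\<^sup>+x\<in>K. ennreal (f x) \<partial>M) = hausdorff_outer (hausdorff_dim K) K" .
  have "(\<integral>\<^sup>+x\<in>K. ennreal (- f x) \<partial>M) = (\<integral>\<^sup>+x. 0 \<partial>M)"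
    by (intro nn_integral_cong) (auto simp: one indicator_def ennreal_neg)
  then have neg: "(\<integral>\<^sup>+x\<in>K. ennreal (- f x) \<partial>M) = 0" by simp
  show ?thesis
    using pos neg
    by (simp add: hausdorff_integral_def hausdorff_size_def ereal_set_integral_def Let_def support M_def
        zero_ennreal.rep_eq)
qed

theorem proposition2p27:
  fixes K :: "real set"
  assumes "K \<in> sets borel"
  shows "hausdorff_size K = hausdorff_integral UNIV (indicat_real K)
    \<and> hausdorff_integral UNIV (indicat_real K) = hausdorff_integral K (\<lambda>_. 1)"
proof -
  have "hausdorff_integral UNIV (indicat_real K) = hausdorff_size K"
    by (rule hausdorff_integral_eq_size[OF assms]) (auto simp: indicator_def)
  moreover have "hausdorff_integral K (\<lambda>_. 1) = hausdorff_size K"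
    by (rule hausdorff_integral_eq_size[OF assms]) auto
  ultimately show ?thesis by simp
qed

end
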